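(* Let $G$ be a group acting by uniform coarse equivalences on a coarsely connected coarse space $(X,\mathcal{E}_X)$. The following statements are equivalent: (1) The action is coarsely cobounded. (2) For every $x\in X$, the orbit map $\rho_x\colon G\to X$, $\rho_x(g)=gx$, is coarsely surjective. (3) The quotient space $X/G$, equipped with the quotient coarse structure, is coarsely bounded.
   Context: A coarse structure on a set $X$ is a collection $\mathcal{E}$ of subsets of $X\times X$ (entourages) that contains the diagonal $\Delta_X$ and is closed under subsets, finite unions, compositions $E\circ F=\{(x,z)\mid \exists y,\ (x,y)\in E,\ (y,z)\in F\}$ and inverses. $(X,\mathcal{E})$ is a coarse space; it is coarsely connected if $\{(x,y)\}\in\mathcal{E}$ for all $x,y\in X$. A subset $B\subseteq X$ is coarsely bounded if $B\times B\in\mathcal{E}$. For $E\subseteq X\times X$ and $A\subseteq X$, $E[A]=\{x\in X\mid \exists a\in A,\ (x,a)\in E\}$. An action of $G$ on $X$ is by uniform coarse equivalences if for every $E\in\mathcal{E}_X$ there is $M_E\in\mathcal{E}_X$ with $\bigcup_{g\in G}gE\subseteq M_E$, where $gE=\{(gx,gy)\mid (x,y)\in E\}$. The action is coarsely cobounded if there is a coarsely bounded $B\subseteq X$ with $GB=X$. A map $\phi$ from a set $S$ to a coarse space $(Y,\mathcal{E}_Y)$ is coarsely surjective if there is $F\in\mathcal{E}_Y$ with $F[\phi(S)]=Y$. With $\pi\colon X\to X/G$ the canonical projection onto the orbit space, the quotient coarse structure on $X/G$ is the coarse structure generated by (the smallest one containing) all sets $(\pi\times\pi)(E)$, $E\in\mathcal{E}_X$.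 *)

theory Defs
  imports "HOL-Algebra.Group_Action"
begin

locale coarse_space =
  fixes X :: "'a set" and \<E> :: "('a \<times> 'a) set set"
  assumes entourage_subset: "E \<in> \<E> \<Longrightarrow> E \<subseteq> X \<times> X"
    and diagonal: "Id_on X \<in> \<E>"
    and subset_closed: "E \<in> \<E> \<Longrightarrow> F \<subseteq> E \<Longrightarrow> F \<in> \<E>"
    and union_closed: "E \<in> \<E> \<Longrightarrow> F \<in> \<E> \<Longrightarrow> E \<union> F \<in> \<E>"
    and comp_closed: "E \<in> \<E> \<Longrightarrow> F \<in> \<E> \<Longrightarrow> E O F \<in> \<E>"
    and inverse_closed: "E \<in> \<E> \<Longrightarrow> E\<inverse> \<in> \<E>"

definition coarsely_connected :: "'a set \<Rightarrow> ('a \<times> 'a) set set \<Rightarrow> bool" where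
  "coarsely_connected X \<E> \<longleftrightarrow> (\<forall>x\<in>X. \<forall>y\<in>X. {(x, y)} \<in> \<E>)"

definition coarsely_bounded :: "'a set \<Rightarrow> ('a \<times> 'a) set set \<Rightarrow> 'a set \<Rightarrow> bool" where
  "coarsely_bounded X \<E> B \<longleftrightarrow> B \<subseteq> X \<and> B \<times> B \<in> \<E>"

text \<open>The set \<open>E[A]\<close>. The points of \<open>A\<close> occupy the second coordinate, so this is the
  relational image of \<open>A\<close> under the converse of \<open>E\<close>, not under \<open>E\<close>.\<close>

definition entourage_nbhd :: "'a set \<Rightarrow> ('a \<times> 'a) set \<Rightarrow> 'a set \<Rightarrow> 'a set" where
  "entourage_nbhd X E A = {x \<in> X. \<exists>a\<in>A. (x, a) \<in> E}"

definition coarsely_surjective ::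
  "'s set \<Rightarrow> ('s \<Rightarrow> 'a) \<Rightarrow> 'a set \<Rightarrow> ('a \<times> 'a) set set \<Rightarrow> bool" where
  "coarsely_surjective S f Y \<E> \<longleftrightarrow> (\<exists>F\<in>\<E>. entourage_nbhd Y F (f ` S) = Y)"

definition generated_coarse_structure ::
  "'a set \<Rightarrow> ('a \<times> 'a) set set \<Rightarrow> ('a \<times> 'a) set set" where
  "generated_coarse_structure Y \<S> = \<Inter>{\<F>. coarse_space Y \<F> \<and> \<S> \<subseteq> \<F>}"

lemma coarse_space_generated:
  assumes "\<And>E. E \<in> \<S> \<Longrightarrow> E \<subseteq> Y \<times> Y"
  shows "coarse_space Y (generated_coarse_structure Y \<S>)"
proof -
  have max: "coarse_space Y (Pow (Y \<times> Y))" "\<S> \<subseteq> Pow (Y \<times> Y)"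
    using assms by (auto simp: coarse_space_def)
  let ?C = "{\<F>. coarse_space Y \<F> \<and> \<S> \<subseteq> \<F>}"
  have C: "coarse_space Y \<F>" if "\<F> \<in> ?C" for \<F>
    using that by simp
  have "coarse_space Y (\<Inter>?C)"
  proof
    show "E \<subseteq> Y \<times> Y" if "E \<in> \<Inter>?C" for E
      using that max by blast
    show "Id_on Y \<in> \<Inter>?C"
      by (intro InterI coarse_space.diagonal C)
    show "F \<in> \<Inter>?C" if "E \<in> \<Inter>?C" "F \<subseteq> E" for E F
      by (rule InterI, rule coarse_space.subset_closed[OF C], assumption) (use that in blast)+
    show "E \<union> F \<in> \<Inter>?C" if "E \<in> \<Inter>?C" "F \<in> \<Inter>?C" for E F
      by (rule InterI, rule coarse_space.union_closed[OF C], assumption) (use that in blast)+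
    show "E O F \<in> \<Inter>?C" if "E \<in> \<Inter>?C" "F \<in> \<Inter>?C" for E F
      by (rule InterI, rule coarse_space.comp_closed[OF C], assumption) (use that in blast)+
    show "E\<inverse> \<in> \<Inter>?C" if "E \<in> \<Inter>?C" for E
      by (rule InterI, rule coarse_space.inverse_closed[OF C], assumption) (use that in blast)+
  qed
  then show ?thesis
    by (simp add: generated_coarse_structure_def)
qed

lemma generated_coarse_structure_superset: "\<S> \<subseteq> generated_coarse_structure Y \<S>"
  by (auto simp: generated_coarse_structure_def)

lemma generated_coarse_structure_least:
  "coarse_space Y \<F> \<Longrightarrow> \<S> \<subseteq> \<F> \<Longrightarrow> generated_coarse_structure Y \<S> \<subseteq> \<F>"
  by (auto simp: generated_coarse_structure_def)

definition uniform_coarse_action ::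
  "('g, 'm) monoid_scheme \<Rightarrow> ('a \<times> 'a) set set \<Rightarrow> ('g \<Rightarrow> 'a \<Rightarrow> 'a) \<Rightarrow> bool" where
  "uniform_coarse_action G \<E> \<phi> \<longleftrightarrow>
     (\<forall>E\<in>\<E>. \<exists>M\<in>\<E>. (\<Union>g\<in>carrier G. map_prod (\<phi> g) (\<phi> g) ` E) \<subseteq> M)"

definition coarsely_cobounded ::
  "('g, 'm) monoid_scheme \<Rightarrow> 'a set \<Rightarrow> ('a \<times> 'a) set set \<Rightarrow> ('g \<Rightarrow> 'a \<Rightarrow> 'a) \<Rightarrow> bool" where
  "coarsely_cobounded G X \<E> \<phi> \<longleftrightarrow>
     (\<exists>B. coarsely_bounded X \<E> B \<and> (\<Union>g\<in>carrier G. \<phi> g ` B) = X)"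

definition orbit_map :: "('g \<Rightarrow> 'a \<Rightarrow> 'a) \<Rightarrow> 'a \<Rightarrow> 'g \<Rightarrow> 'a" where
  "orbit_map \<phi> x = (\<lambda>g. \<phi> g x)"

text \<open>The orbit space is \<^term>\<open>orbits G X \<phi>\<close>, and the projection onto it is \<^term>\<open>orbit G \<phi>\<close>.\<close>

definition quotient_coarse_structure ::
  "('g, 'm) monoid_scheme \<Rightarrow> 'a set \<Rightarrow> ('a \<times> 'a) set set \<Rightarrow> ('g \<Rightarrow> 'a \<Rightarrow> 'a)
    \<Rightarrow> ('a set \<times> 'a set) set set" where
  "quotient_coarse_structure G X \<E> \<phi> =
     generated_coarse_structure (orbits G X \<phi>)
       {map_prod (orbit G \<phi>) (orbit G \<phi>) ` E | E. E \<in> \<E>}"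

end

theory Submission
  imports Defs
begin

text \<open>
  An action by uniform coarse equivalences can move any \<open>E\<close>-close pair of points to another position
  in its orbit at the cost of replacing \<open>E\<close> by one larger entourage \<open>M\<close>, which depends on \<open>E\<close> but
  not on the group element. For nonempty \<open>X\<close>, all three statements then say that every orbit meets the
  \<open>E\<close>-neighbourhood of a single point, for some entourage \<open>E\<close>.

  If \<open>X = GB\<close> with \<open>B\<close> bounded, then connectedness makes \<open>B \<times> {x}\<close> an entourage, and translating it
  shows that every point is uniformly close to the orbit of \<open>x\<close>
  (\<open>cobounded_imp_orbit_map_surjective\<close>). If the orbit of one point is coarsely dense, then its class
  in \<open>X/G\<close> is uniformly close to every other class, so \<open>X/G\<close> is bounded
  (\<open>orbit_map_surjective_imp_quotient_bounded\<close>). For the return from \<open>X/G\<close> to \<open>X\<close> one has to know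
  the quotient structure concretely, although it is defined by generation: its entourages are exactly
  the subsets of the images \<open>(\<pi> \<times> \<pi>)(E)\<close> (\<open>quotient_entourage_iff\<close>). These images are
  closed under composition up to enlargement because a pair of close orbits lifts to a pair of close
  points with prescribed second point (\<open>lift_close_orbits\<close>). If \<open>X/G\<close> is bounded, lifting
  all pairs \<open>(Gy, Gx)\<close> with second point \<open>x\<close> places a representative of every orbit in a fixed
  neighbourhood of \<open>x\<close> (\<open>quotient_bounded_imp_cobounded\<close>).
\<close>

section \<open>Uniform translates and lifts of close orbits\<close>

locale uniform_action = coarse_space X \<E> + group_action G X \<phi>
  for G (structure) and X :: "'x set" and \<E> \<phi> +
  assumes uniform: "uniform_coarse_action G \<E> \<phi>"
begin

definition proj2 :: "('x \<times> 'x) set \<Rightarrow> ('x set \<times> 'x set) set" where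
  "proj2 E = map_prod (orbit G \<phi>) (orbit G \<phi>) ` E"

lemma proj2_iff:
  "(p, q) \<in> proj2 E \<longleftrightarrow> (\<exists>x y. (x, y) \<in> E \<and> orbit G \<phi> x = p \<and> orbit G \<phi> y = q)"
  unfolding proj2_def by (auto intro!: rev_image_eqI)

lemma uniform_entourage:
  assumes "E \<in> \<E>"
  shows "\<exists>M\<in>\<E>. \<forall>g\<in>carrier G. \<forall>x y. (x, y) \<in> E \<longrightarrow> (\<phi> g x, \<phi> g y) \<in> M"
proof -
  obtain M where "M \<in> \<E>" and "(\<Union>g\<in>carrier G. map_prod (\<phi> g) (\<phi> g) ` E) \<subseteq> M"
    using assms uniform unfolding uniform_coarse_action_def by blast
  moreover have "(\<phi> g x, \<phi> g y) \<in> (\<Union>g\<in>carrier G. map_prod (\<phi> g) (\<phi> g) ` E)"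
    if "g \<in> carrier G" "(x, y) \<in> E" for g x y
    using that by (intro UN_I[of g] image_eqI[of _ _ "(x, y)"]) auto
  ultimately show ?thesis
    by blast
qed

lemma orbit_eqI:
  assumes "x \<in> X" "g \<in> carrier G"
  shows "orbit G \<phi> (\<phi> g x) = orbit G \<phi> x"
proof -
  have y: "\<phi> g x \<in> X"
    using element_image assms by blast
  have "\<phi> g x \<in> orbit G \<phi> x" "\<phi> g x \<in> orbit G \<phi> (\<phi> g x)"
    using assms orbit_refl[OF y] by (auto simp: orbit_def)
  moreover have "orbit G \<phi> x \<in> orbits G X \<phi>" "orbit G \<phi> (\<phi> g x) \<in> orbits G X \<phi>"
    using assms y by (auto simp: orbits_def)
  ultimately show ?thesis
    using disjoint_union by blast
qed

lemma orbit_eqE: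
  assumes "orbit G \<phi> x = orbit G \<phi> y" "y \<in> X"
  obtains g where "g \<in> carrier G" "y = \<phi> g x"
proof -
  have "y \<in> orbit G \<phi> x"
    using assms orbit_refl by simp
  then show thesis
    using that by (auto simp: orbit_def)
qed

text \<open>The pair of orbits has some \<open>E\<close>-close pair of representatives \<open>(a, b)\<close>; the group element that
  carries \<open>b\<close> to the prescribed point carries \<open>a\<close> along with it. A single \<open>M\<close> serves all pairs.\<close>

lemma lift_close_orbits:
  assumes "E \<in> \<E>"
  shows "\<exists>M\<in>\<E>. \<forall>p. \<forall>y\<in>X. (p, orbit G \<phi> y) \<in> proj2 E \<longrightarrow> (\<exists>x. (x, y) \<in> M \<and> orbit G \<phi> x = p)"
proof -
  obtain M where M: "M \<in> \<E>"
      "\<forall>g\<in>carrier G. \<forall>x y. (x, y) \<in> E \<longrightarrow> (\<phi> g x, \<phi> g y) \<in> M"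
    using uniform_entourage[OF assms] by blast
  have "\<exists>x. (x, y) \<in> M \<and> orbit G \<phi> x = p"
    if y: "y \<in> X" and p: "(p, orbit G \<phi> y) \<in> proj2 E" for p y
  proof -
    obtain a b where ab: "(a, b) \<in> E" "orbit G \<phi> a = p" "orbit G \<phi> b = orbit G \<phi> y"
      using p unfolding proj2_iff by blast
    obtain g where g: "g \<in> carrier G" "y = \<phi> g b"
      using orbit_eqE[OF ab(3) y] .
    have "a \<in> X"
      using ab(1) entourage_subset[OF assms] by blast
    then have "orbit G \<phi> (\<phi> g a) = p"
      using orbit_eqI g(1) ab(2) by simp
    then show ?thesis
      using M(2) g ab(1) by blast
  qed
  then show ?thesis
    using M(1) by blast
qed

section \<open>Entourages of the orbit space\<close>

text \<open>For a general surjection the images of entourages do not compose: \<open>(p, q)\<close> and \<open>(q, r)\<close> may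
  come from pairs that use different points over \<open>q\<close>. Here the first pair can be lifted again so
  that the middle points agree.\<close>

lemma coarse_space_projected_entourages:
  "coarse_space (orbits G X \<phi>) {F. \<exists>E\<in>\<E>. F \<subseteq> proj2 E}"
proof (unfold_locales, goal_cases)
  case (1 F)
  then obtain E where E: "E \<in> \<E>" "F \<subseteq> proj2 E" by blast
  have "proj2 E \<subseteq> orbits G X \<phi> \<times> orbits G X \<phi>"
    using entourage_subset[OF E(1)] by (auto simp: orbits_def proj2_def)
  then show ?case
    using E(2) by blast
next
  case 2
  have "Id_on (orbits G X \<phi>) \<subseteq> proj2 (Id_on X)"
    by (auto simp: orbits_def proj2_iff Id_on_iff)
  then show ?case
    using diagonal by (intro CollectI bexI)
next
  case (3 F F')
  then show ?case by blast
next
  case (4 F F')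
  then obtain E E' where E: "E \<in> \<E>" "F \<subseteq> proj2 E" and E': "E' \<in> \<E>" "F' \<subseteq> proj2 E'" by blast
  have "F \<union> F' \<subseteq> proj2 (E \<union> E')"
    using E(2) E'(2) unfolding proj2_def image_Un by (rule Un_mono)
  then show ?case
    using union_closed[OF E(1) E'(1)] by (intro CollectI bexI)
next
  case (5 F F')
  then obtain E E' where E: "E \<in> \<E>" "F \<subseteq> proj2 E" and E': "E' \<in> \<E>" "F' \<subseteq> proj2 E'" by blast
  obtain M where M: "M \<in> \<E>"
      "\<forall>p. \<forall>y\<in>X. (p, orbit G \<phi> y) \<in> proj2 E \<longrightarrow> (\<exists>x. (x, y) \<in> M \<and> orbit G \<phi> x = p)"
    using lift_close_orbits[OF E(1)] by blast
  have "F O F' \<subseteq> proj2 (M O E')"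
  proof (rule subrelI)
    fix p r assume "(p, r) \<in> F O F'"
    then obtain q where q: "(p, q) \<in> F" "(q, r) \<in> F'"
      by (rule relcompEpair)
    obtain y z where yz: "(y, z) \<in> E'" "q = orbit G \<phi> y" "r = orbit G \<phi> z"
      using subsetD[OF E'(2) q(2)] unfolding proj2_iff by blast
    have p: "(p, orbit G \<phi> y) \<in> proj2 E"
      using subsetD[OF E(2) q(1)] yz(2) by simp
    have "y \<in> X"
      using yz(1) entourage_subset[OF E'(1)] by blast
    then obtain x where "(x, y) \<in> M" "orbit G \<phi> x = p"
      using M(2)[rule_format, OF _ p] by blast
    then show "(p, r) \<in> proj2 (M O E')"
      using yz unfolding proj2_iff by blast
  qed
  then show ?case
    using comp_closed[OF M(1) E'(1)] by (intro CollectI bexI)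
next
  case (6 F)
  then obtain E where "E \<in> \<E>" "F \<subseteq> proj2 E" by blast
  then have "F\<inverse> \<subseteq> (proj2 E)\<inverse>" "E\<inverse> \<in> \<E>"
    using inverse_closed by simp_all
  moreover have "(proj2 E)\<inverse> = proj2 (E\<inverse>)"
    unfolding set_eq_iff split_paired_All converse_iff proj2_iff by blast
  ultimately show ?case by auto
qed

lemma coarse_space_quotient: "coarse_space (orbits G X \<phi>) (quotient_coarse_structure G X \<E> \<phi>)"
  unfolding quotient_coarse_structure_def proj2_def[symmetric]
proof (rule coarse_space_generated)
  fix F assume "F \<in> {proj2 E |E. E \<in> \<E>}"
  then show "F \<subseteq> orbits G X \<phi> \<times> orbits G X \<phi>"
    by (intro coarse_space.entourage_subset[OF coarse_space_projected_entourages]) blast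
qed

lemma quotient_entourage_iff:
  "F \<in> quotient_coarse_structure G X \<E> \<phi> \<longleftrightarrow> (\<exists>E\<in>\<E>. F \<subseteq> proj2 E)"
proof
  have "quotient_coarse_structure G X \<E> \<phi> \<subseteq> {F. \<exists>E\<in>\<E>. F \<subseteq> proj2 E}"
    unfolding quotient_coarse_structure_def proj2_def[symmetric]
    by (rule generated_coarse_structure_least[OF coarse_space_projected_entourages]) blast
  then show "F \<in> quotient_coarse_structure G X \<E> \<phi> \<Longrightarrow> \<exists>E\<in>\<E>. F \<subseteq> proj2 E"
    by blast
next
  assume "\<exists>E\<in>\<E>. F \<subseteq> proj2 E"
  then obtain E where E: "E \<in> \<E>" "F \<subseteq> proj2 E" by blast
  have "proj2 E \<in> quotient_coarse_structure G X \<E> \<phi>"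
    unfolding quotient_coarse_structure_def proj2_def[symmetric]
    by (rule subsetD[OF generated_coarse_structure_superset]) (use E(1) in blast)
  then show "F \<in> quotient_coarse_structure G X \<E> \<phi>"
    using coarse_space.subset_closed[OF coarse_space_quotient] E(2) by blast
qed

section \<open>Cobounded actions, coarsely dense orbits, bounded quotients\<close>

text \<open>Connectedness enters here because \<open>x\<close> is arbitrary, and a bounded \<open>B\<close> with \<open>GB = X\<close> need not
  contain it: a single pair \<open>(b, x)\<close> with \<open>b \<in> B\<close> makes all of \<open>B\<close> uniformly close to \<open>x\<close>.\<close>

lemma cobounded_imp_orbit_map_surjective:
  assumes "coarsely_connected X \<E>" "coarsely_cobounded G X \<E> \<phi>" "x \<in> X"
  shows "coarsely_surjective (carrier G) (orbit_map \<phi> x) X \<E>"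
proof -
  obtain B where B: "B \<subseteq> X" "B \<times> B \<in> \<E>" "(\<Union>g\<in>carrier G. \<phi> g ` B) = X"
    using assms(2) unfolding coarsely_cobounded_def coarsely_bounded_def by blast
  obtain b where b: "b \<in> B"
    using B(3) assms(3) by blast
  have "{(b, x)} \<in> \<E>"
    using assms(1,3) b B(1) unfolding coarsely_connected_def by blast
  moreover have "(B \<times> B) O {(b, x)} = B \<times> {x}"
    using b by auto
  ultimately have "B \<times> {x} \<in> \<E>"
    using comp_closed[OF B(2)] by metis
  then obtain M where M: "M \<in> \<E>"
      "\<forall>g\<in>carrier G. \<forall>y z. (y, z) \<in> B \<times> {x} \<longrightarrow> (\<phi> g y, \<phi> g z) \<in> M"
    using uniform_entourage by blast
  have "\<exists>g\<in>carrier G. (y, \<phi> g x) \<in> M" if y: "y \<in> X" for y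
  proof -
    obtain g c where "g \<in> carrier G" "c \<in> B" "y = \<phi> g c"
      using y B(3) by blast
    then show ?thesis
      using M(2) by blast
  qed
  then have "entourage_nbhd X M (orbit_map \<phi> x ` carrier G) = X"
    unfolding entourage_nbhd_def orbit_map_def by blast
  then show ?thesis
    using M(1) unfolding coarsely_surjective_def by blast
qed

text \<open>Coarse density of the orbit of \<open>x\<close> says that every class lies in the \<open>F\<close>-neighbourhood of the
  class of \<open>x\<close>, so any two classes are related by going through it.\<close>

lemma orbit_map_surjective_imp_quotient_bounded:
  assumes "x \<in> X" "coarsely_surjective (carrier G) (orbit_map \<phi> x) X \<E>"
  shows "coarsely_bounded (orbits G X \<phi>) (quotient_coarse_structure G X \<E> \<phi>) (orbits G X \<phi>)"
proof -
  interpret Q: coarse_space "orbits G X \<phi>" "quotient_coarse_structure G X \<E> \<phi>"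
    by (rule coarse_space_quotient)
  obtain F where F: "F \<in> \<E>" "entourage_nbhd X F (orbit_map \<phi> x ` carrier G) = X"
    using assms(2) unfolding coarsely_surjective_def by blast
  have "orbits G X \<phi> \<times> {orbit G \<phi> x} \<subseteq> proj2 F"
  proof (rule subrelI)
    fix p q assume "(p, q) \<in> orbits G X \<phi> \<times> {orbit G \<phi> x}"
    then obtain y where y: "y \<in> X" "p = orbit G \<phi> y" "q = orbit G \<phi> x"
      by (auto simp: orbits_def)
    then obtain g where "g \<in> carrier G" "(y, \<phi> g x) \<in> F"
      using F(2) unfolding entourage_nbhd_def orbit_map_def by blast
    then show "(p, q) \<in> proj2 F"
      using y orbit_eqI[OF assms(1)] unfolding proj2_iff by blast
  qed
  then have S: "orbits G X \<phi> \<times> {orbit G \<phi> x} \<in> quotient_coarse_structure G X \<E> \<phi>"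
    using F(1) quotient_entourage_iff by blast
  have "orbits G X \<phi> \<times> orbits G X \<phi> =
      (orbits G X \<phi> \<times> {orbit G \<phi> x}) O (orbits G X \<phi> \<times> {orbit G \<phi> x})\<inverse>"
    by auto
  then show ?thesis
    using Q.comp_closed[OF S Q.inverse_closed[OF S]] unfolding coarsely_bounded_def by simp
qed

lemma quotient_bounded_imp_cobounded:
  assumes "coarsely_bounded (orbits G X \<phi>) (quotient_coarse_structure G X \<E> \<phi>) (orbits G X \<phi>)"
  shows "coarsely_cobounded G X \<E> \<phi>"
proof (cases "X = {}")
  case True
  then show ?thesis
    using diagonal unfolding coarsely_cobounded_def coarsely_bounded_def by auto
next
  case False
  then obtain x where x: "x \<in> X" by blast
  obtain E where E: "E \<in> \<E>" "orbits G X \<phi> \<times> orbits G X \<phi> \<subseteq> proj2 E"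
    using assms quotient_entourage_iff unfolding coarsely_bounded_def by blast
  obtain M where M: "M \<in> \<E>"
      "\<forall>p. \<forall>y\<in>X. (p, orbit G \<phi> y) \<in> proj2 E \<longrightarrow> (\<exists>z. (z, y) \<in> M \<and> orbit G \<phi> z = p)"
    using lift_close_orbits[OF E(1)] by blast
  \<comment> \<open>The lifts of all pairs of orbits ending in the orbit of \<open>x\<close> can end at \<open>x\<close> itself, so their first
      points are pairwise close through \<open>x\<close>.\<close>
  define B where "B = {z. (z, x) \<in> M}"
  have BX: "B \<subseteq> X"
    using entourage_subset[OF M(1)] unfolding B_def by blast
  have "B \<times> B \<subseteq> M O M\<inverse>"
    unfolding B_def by blast
  then have "B \<times> B \<in> \<E>"
    by (rule subset_closed[OF comp_closed[OF M(1) inverse_closed[OF M(1)]]])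
  moreover have "(\<Union>g\<in>carrier G. \<phi> g ` B) = X"
  proof
    show "(\<Union>g\<in>carrier G. \<phi> g ` B) \<subseteq> X"
      using BX surj_prop by blast
    show "X \<subseteq> (\<Union>g\<in>carrier G. \<phi> g ` B)"
    proof
      fix y assume y: "y \<in> X"
      have "(orbit G \<phi> y, orbit G \<phi> x) \<in> orbits G X \<phi> \<times> orbits G X \<phi>"
        using x y unfolding orbits_def by blast
      then have "(orbit G \<phi> y, orbit G \<phi> x) \<in> proj2 E"
        by (rule subsetD[OF E(2)])
      then have "\<exists>z. (z, x) \<in> M \<and> orbit G \<phi> z = orbit G \<phi> y"
        by (rule M(2)[rule_format, OF x])
      then obtain z where z: "z \<in> B" "orbit G \<phi> z = orbit G \<phi> y"
        unfolding B_def by blast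
      obtain g where "g \<in> carrier G" "y = \<phi> g z"
        using orbit_eqE[OF z(2) y] .
      then show "y \<in> (\<Union>g\<in>carrier G. \<phi> g ` B)"
        using z(1) by blast
    qed
  qed
  ultimately show ?thesis
    using BX unfolding coarsely_cobounded_def coarsely_bounded_def by blast
qed

end

theorem theorem5p2:
  fixes G :: "('g, 'm) monoid_scheme" and X :: "'a set"
    and \<E> :: "('a \<times> 'a) set set" and \<phi> :: "'g \<Rightarrow> 'a \<Rightarrow> 'a"
  assumes "coarse_space X \<E>"
    and "coarsely_connected X \<E>"
    and "group_action G X \<phi>"
    and "uniform_coarse_action G \<E> \<phi>"
  shows "(coarsely_cobounded G X \<E> \<phi> \<longleftrightarrow>
           (\<forall>x\<in>X. coarsely_surjective (carrier G) (orbit_map \<phi> x) X \<E>)) \<and>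
         ((\<forall>x\<in>X. coarsely_surjective (carrier G) (orbit_map \<phi> x) X \<E>) \<longleftrightarrow>
           coarsely_bounded (orbits G X \<phi>) (quotient_coarse_structure G X \<E> \<phi>) (orbits G X \<phi>))"
proof -
  interpret uniform_action G X \<E> \<phi>
    using assms(1,3,4) by (simp add: uniform_action_def uniform_action_axioms_def)
  let ?surj = "\<forall>x\<in>X. coarsely_surjective (carrier G) (orbit_map \<phi> x) X \<E>"
  let ?bdd = "coarsely_bounded (orbits G X \<phi>) (quotient_coarse_structure G X \<E> \<phi>) (orbits G X \<phi>)"
  have "?surj" if "coarsely_cobounded G X \<E> \<phi>"
    using cobounded_imp_orbit_map_surjective[OF assms(2) that] by blast
  moreover have "?bdd" if "?surj"
  proof (cases "X = {}")
    case True
    \<comment> \<open>No orbit map exists to start from, but the orbit space is empty and its square is the diagonal.\<close>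
    then have "orbits G X \<phi> = {}"
      by (simp add: orbits_def)
    then show ?thesis
      using coarse_space.diagonal[OF coarse_space_quotient] unfolding coarsely_bounded_def by simp
  next
    case False
    then show ?thesis
      using that orbit_map_surjective_imp_quotient_bounded by blast
  qed
  ultimately show ?thesis
    using quotient_bounded_imp_cobounded by blast
qed

end
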